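(* Let a network consist of $N$ nodes indexed by $1,\dots,N$, with real locations $p_1,\dots,p_N\in\mathbb{R}^2$, predicted locations $q_1,\dots,q_N\in\mathbb{R}^2$, and communication radius $R>0$. Let $Hop^{real}_{i,j}$ and $Hop^{pred}_{i,j}$ denote the hop-counts between nodes $i$ and $j$ derived from the real locations and from the predicted locations, respectively, and let $AC^{CC}_{i,j}\in\{0,1\}$ be the connectivity-consistency activation condition. If there are two nodes $i,j$ in the network such that $Hop^{real}_{i,j}\neq Hop^{pred}_{i,j}$, then there exist nodes $i',j'$ in the network such that $AC^{CC}_{i',j'}=1$.
   Context: Real connectivity: two distinct nodes $i\ne j$ are directly connected in the real network iff the Euclidean distance $Dist^{real}_{i,j}=\|p_i-p_j\|$ satisfies $Dist^{real}_{i,j}\le R$. Predicted connectivity: two distinct nodes $i\neq j$ are directly connected in the predicted network iff $Dist^{pred}_{i,j}=\|q_i-q_j\|\le R$. This gives two simple undirected graphs on the same vertex set $\{1,\dots,N\}$, the real graph and the predicted graph. The hop-count $Hop^{real}_{i,j}$ (respectively $Hop^{pred}_{i,j}$) is the graph distance, i.e. the minimal number of edges of a path from $i$ to $j$, in the real graph (respectively in the predicted graph); in particular it equals $0$ iff $i=j$ and equals $1$ iff $i$ and $j$ are distinct and directly connected. By convention the hop-count is $+\infty$ if no path exists. The connectivity-consistency activation condition is $$AC^{CC}_{i,j}=\begin{cases}1, & \text{if } (Hop^{real}_{i,j}=1 \text{ and } Hop^{pred}_{i,j}>1)\ \text{ or }\ (Hop^{real}_{i,j}>1 \text{ and } Hop^{pred}_{i,j}=1),\\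 0, & \text{otherwise.}\end{cases}$$ *)

theory Defs
  imports "HOL-Analysis.Analysis" "Graph_Theory.Pair_Digraph"
begin

text \<open>
  An undirected simple graph is represented, as usual in the graph library, by a symmetric
  loop-free set of ordered pairs; each edge occurs in both orientations.
\<close>

definition disk_graph :: "nat \<Rightarrow> real \<Rightarrow> (nat \<Rightarrow> real ^ 2) \<Rightarrow> nat pair_pre_digraph" where
  "disk_graph N R loc =
     \<lparr> pverts = {1..N},
       parcs = {(i, j). i \<in> {1..N} \<and> j \<in> {1..N} \<and> i \<noteq> j \<and> norm (loc i - loc j) \<le> R} \<rparr>"

text \<open>
  The infimum in \<^typ>\<open>enat\<close> is a minimum when some path exists and is \<^term>\<open>\<infinity> :: enat\<close> otherwise.
  A path is given by its list of edges, so its length is its number of edges.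
\<close>

definition hop_count :: "nat \<Rightarrow> real \<Rightarrow> (nat \<Rightarrow> real ^ 2) \<Rightarrow> nat \<Rightarrow> nat \<Rightarrow> enat" where
  "hop_count N R loc i j =
     (INF es \<in> {es. pre_digraph.apath (with_proj (disk_graph N R loc)) i es j}. enat (length es))"

definition AC_CC ::
  "nat \<Rightarrow> real \<Rightarrow> (nat \<Rightarrow> real ^ 2) \<Rightarrow> (nat \<Rightarrow> real ^ 2) \<Rightarrow> nat \<Rightarrow> nat \<Rightarrow> nat" where
  "AC_CC N R p q i j =
     (if (hop_count N R p i j = 1 \<and> hop_count N R q i j > 1)
       \<or> (hop_count N R p i j > 1 \<and> hop_count N R q i j = 1)
      then 1 else 0)"

lemma pverts_disk_graph: "pverts (disk_graph N R loc) = {1..N}"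
  and parcs_disk_graph: "(a, b) \<in> parcs (disk_graph N R loc) \<longleftrightarrow>
    a \<in> {1..N} \<and> b \<in> {1..N} \<and> a \<noteq> b \<and> norm (loc a - loc b) \<le> R"
  by (auto simp: disk_graph_def)

lemma pair_graph_disk_graph: "pair_graph (disk_graph N R loc)"
proof
  let ?G = "disk_graph N R loc"
  show "finite (pverts ?G)" by (simp add: disk_graph_def)
  show "finite (parcs ?G)"
    by (rule finite_subset[of _ "{1..N} \<times> {1..N}"]) (auto simp: disk_graph_def)
  show "symmetric (with_proj ?G)"
    by (auto simp: symmetric_def disk_graph_def sym_def norm_minus_commute)
qed (auto simp: disk_graph_def)

lemma hop_count_infinite_iff:
  "hop_count N R loc i j = \<infinity> \<longleftrightarrow>
     (\<nexists>es. pre_digraph.apath (with_proj (disk_graph N R loc)) i es j)"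
proof
  assume *: "hop_count N R loc i j = \<infinity>"
  show "\<nexists>es. pre_digraph.apath (with_proj (disk_graph N R loc)) i es j"
  proof
    assume "\<exists>es. pre_digraph.apath (with_proj (disk_graph N R loc)) i es j"
    then obtain es where "pre_digraph.apath (with_proj (disk_graph N R loc)) i es j" ..
    then have "hop_count N R loc i j \<le> enat (length es)"
      unfolding hop_count_def by (intro INF_lower) simp
    with * show False by simp
  qed
qed (simp add: hop_count_def top_enat_def)

lemma hop_count_attained:
  assumes "hop_count N R loc i j = enat n"
  shows "\<exists>es. pre_digraph.apath (with_proj (disk_graph N R loc)) i es j \<and> length es = n"
proof -
  let ?S = "(\<lambda>es. enat (length es)) ` {es. pre_digraph.apath (with_proj (disk_graph N R loc)) i es j}"
  have "?S \<noteq> {}"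
    using assms hop_count_infinite_iff[of N R loc i j] by auto
  then have "Inf ?S \<in> ?S"
    unfolding Inf_enat_def by (metis (mono_tags, lifting) LeastI ex_in_conv)
  then show ?thesis using assms unfolding hop_count_def by auto
qed

lemma hop_count_eq_0_iff:
  assumes "i \<in> {1..N}"
  shows "hop_count N R loc i j = 0 \<longleftrightarrow> i = j"
proof
  interpret pair_graph "disk_graph N R loc" by (rule pair_graph_disk_graph)
  { assume "hop_count N R loc i j = 0"
    then show "i = j"
      using hop_count_attained[of N R loc i j 0] by (auto simp: zero_enat_def apath_Nil_iff) }
  { assume "i = j"
    then have "apath i [] j" using assms by (simp add: apath_Nil_iff pverts_disk_graph parcs_disk_graph)
    then have "hop_count N R loc i j \<le> enat (length ([] :: (nat \<times> nat) list))"
      unfolding hop_count_def by (intro INF_lower) simp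
    then show "hop_count N R loc i j = 0" by (simp add: zero_enat_def[symmetric]) }
qed

lemma hop_count_eq_1_iff:
  assumes "i \<in> {1..N}" "j \<in> {1..N}"
  shows "hop_count N R loc i j = 1 \<longleftrightarrow> i \<noteq> j \<and> norm (loc i - loc j) \<le> R"
proof
  interpret pair_graph "disk_graph N R loc" by (rule pair_graph_disk_graph)
  { assume "hop_count N R loc i j = 1"
    then obtain es where "apath i es j" "length es = 1"
      using hop_count_attained[of N R loc i j 1] by (auto simp: one_enat_def)
    then show "i \<noteq> j \<and> norm (loc i - loc j) \<le> R"
      by (cases es) (auto simp: apath_simps pverts_disk_graph parcs_disk_graph) }
  { assume *: "i \<noteq> j \<and> norm (loc i - loc j) \<le> R"
    then have "apath i [(i, j)] j"
      using assms by (simp add: apath_simps pverts_disk_graph parcs_disk_graph)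
    then have "hop_count N R loc i j \<le> enat (length [(i, j)])"
      unfolding hop_count_def by (intro INF_lower) simp
    moreover have "hop_count N R loc i j \<noteq> 0"
      using hop_count_eq_0_iff[OF assms(1)] * by simp
    ultimately show "hop_count N R loc i j = 1"
      by (metis One_nat_def Suc_ile_eq antisym i0_lb length_Cons list.size(3) one_enat_def
          order_le_imp_less_or_eq zero_enat_def) }
qed

end

theory Submission
  imports Defs
begin

text \<open>By contraposition. If \<open>AC_CC\<close> is 1 nowhere, the real and predicted networks
  have the same pairs at hop-count 1 (\<open>AC_CC_eq_1_iff\<close>). These pairs are the edges, so
  the two graphs coincide (\<open>disk_graph_eq_if_hop_count_1_eq\<close>), and with them all
  hop-counts.\<close>

lemma enat_cases_01_gt:
  fixes n :: enat
  shows "n = 0 \<or> n = 1 \<or> n > 1"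
  by (metis ileI1 less_le one_eSuc i0_lb)

text \<open>Hop-count 0 means \<open>i = j\<close> in either network, so it occurs in both or in
  neither. Hence a value other than 1 facing a 1 must exceed 1, infinity included.\<close>

lemma AC_CC_eq_1_iff:
  assumes i: "i \<in> {1..N}" and j: "j \<in> {1..N}"
  shows "AC_CC N R p q i j = 1 \<longleftrightarrow>
    (hop_count N R p i j = 1) \<noteq> (hop_count N R q i j = 1)"
proof -
  have "hop_count N R p i j = 0 \<longleftrightarrow> hop_count N R q i j = 0"
    by (simp only: hop_count_eq_0_iff[OF i])
  then show ?thesis
    unfolding AC_CC_def
    using enat_cases_01_gt[of "hop_count N R p i j"] enat_cases_01_gt[of "hop_count N R q i j"]
    by auto
qed

text \<open>The vertex set is fixed by \<open>N\<close>, and the edges are exactly the pairs at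
  hop-count 1.\<close>

lemma disk_graph_eq_if_hop_count_1_eq:
  assumes "\<And>i j. i \<in> {1..N} \<Longrightarrow> j \<in> {1..N} \<Longrightarrow>
    hop_count N R p i j = 1 \<longleftrightarrow> hop_count N R q i j = 1"
  shows "disk_graph N R p = disk_graph N R q"
proof -
  have "i \<noteq> j \<and> norm (p i - p j) \<le> R \<longleftrightarrow> i \<noteq> j \<and> norm (q i - q j) \<le> R"
    if "i \<in> {1..N}" "j \<in> {1..N}" for i j
    using assms[OF that] by (simp only: hop_count_eq_1_iff[OF that])
  then show ?thesis
    unfolding disk_graph_def by auto
qed

theorem proposition1:
  fixes N :: nat and R :: real and p q :: "nat \<Rightarrow> real ^ 2"
  assumes "R > 0"
    and "\<exists>i \<in> {1..N}. \<exists>j \<in> {1..N}. hop_count N R p i j \<noteq> hop_count N R q i j"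
  shows "\<exists>i' \<in> {1..N}. \<exists>j' \<in> {1..N}. AC_CC N R p q i' j' = 1"
proof (rule ccontr)
  assume "\<not> ?thesis"
  then have "disk_graph N R p = disk_graph N R q"
    by (intro disk_graph_eq_if_hop_count_1_eq) (metis AC_CC_eq_1_iff)
  \<comment> \<open>\<open>hop_count\<close> depends on the locations only through
    \<open>disk_graph\<close>.\<close>
  then have "hop_count N R p = hop_count N R q"
    by (simp add: hop_count_def fun_eq_iff)
  with assms(2) show False by simp
qed

end
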